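(* Let $X$ be a weighted graph on $n$ vertices, let $M\in\{A(X),L(X),Q(X)\}$, let $U(t)=e^{\mathrm{i}tM}$, and let $u$ be a vertex of $X$. The following are equivalent. (1) Local $\epsilon$-uniform mixing occurs at $u$ (relative to $M$). (2) There is a sequence $\{\tau_m\}\subseteq\mathbb{R}$ and a vector $\boldsymbol{\mu}\in\mathbb{C}^n$ all of whose entries have modulus $1$ such that $\lim_{m\to\infty}\sqrt{n}\,U(\tau_m)\mathbf{e}_u=\boldsymbol{\mu}$. (3) There is a sequence $\{\tau_m\}\subseteq\mathbb{R}$ and a vector $\boldsymbol{\mu}\in\mathbb{C}^n$ all of whose entries have modulus $1$ such that, for every $\lambda\in\Phi_{\mathbf{e}_u}$, the limit $\lim_{m\to\infty}e^{\mathrm{i}\tau_m\lambda}$ exists and $\big(\lim_{m\to\infty}e^{\mathrm{i}\tau_m\lambda}\big)\sqrt{n}\,E_\lambda\mathbf{e}_u=E_\lambda\boldsymbol{\mu}$. Moreover, the condition in (3) is equivalent to: for each eigenpair $(\mathbf{v},\lambda)$ of $M$ with $\lambda\in\Phi_{\mathbf{e}_u}$, the limit $\lim_{m\to\infty}e^{\mathrm{i}\tau_m\lambda}$ exists and $\big(\lim_{m\to\infty}e^{\mathrm{i}\tau_m\lambda}\big)\sqrt{n}\,(\mathbf{v}^T\mathbf{e}_u)=\mathbf{v}^T\boldsymbol{\mu}$.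
   Context: Graphs are finite, simple, undirected and connected, with positive real edge weights. $A(X)$ is the weighted adjacency matrix, $D(X)$ is the diagonal matrix of vertex degrees (degree = sum of weights of incident edges), $L(X)=D(X)-A(X)$ is the Laplacian and $Q(X)=D(X)+A(X)$ the signless Laplacian. $\mathbf{e}_u$ is the characteristic vector of $u$, $\mathbf{1}$ is the all-ones vector, $\circ$ is the entrywise (Schur) product. For an eigenvalue $\lambda$ of $M$, $E_\lambda$ is the orthogonal projection onto the $\lambda$-eigenspace of $M$. The eigenvalue support of a vector $\mathbf{x}$ is $\Phi_{\mathbf{x}}=\{\lambda\in\mathrm{spec}(M): E_\lambda\mathbf{x}\neq\mathbf{0}\}$. Local $\epsilon$-uniform mixing occurs at $u$ relative to $M$ if for each $\epsilon>0$ there is a time $\tau\in\mathbb{R}$ such that $\big\|(U(\tau)\mathbf{e}_u)\circ(\overline{U(\tau)}\mathbf{e}_u)-\tfrac1n\mathbf{1}\big\|<\epsilon$. *)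

theory Defs
  imports "HOL-Analysis.Analysis"
begin

text \<open>
  The vertex set is the finite type \<open>'n\<close>; an edge is a two-element vertex set, so loops, multiple
  edges and orientations are excluded. Values of \<open>w\<close> outside \<open>E\<close> are irrelevant.
\<close>

definition weighted_graph :: "'n::finite set set \<Rightarrow> ('n set \<Rightarrow> real) \<Rightarrow> bool" where
  "weighted_graph E w \<longleftrightarrow>
     (\<forall>e\<in>E. card e = 2) \<and> (\<forall>e\<in>E. 0 < w e) \<and> (\<forall>x y. (x, y) \<in> {(a, b). {a, b} \<in> E}\<^sup>*)"

definition adjacency_matrix :: "'n::finite set set \<Rightarrow> ('n set \<Rightarrow> real) \<Rightarrow> real^'n^'n" where
  "adjacency_matrix E w = (\<chi> i j. if {i, j} \<in> E then w {i, j} else 0)"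

definition weighted_degree :: "'n::finite set set \<Rightarrow> ('n set \<Rightarrow> real) \<Rightarrow> 'n \<Rightarrow> real" where
  "weighted_degree E w i = (\<Sum>e\<in>{e \<in> E. i \<in> e}. w e)"

definition degree_matrix :: "'n::finite set set \<Rightarrow> ('n set \<Rightarrow> real) \<Rightarrow> real^'n^'n" where
  "degree_matrix E w = (\<chi> i j. if i = j then weighted_degree E w i else 0)"

definition laplacian :: "'n::finite set set \<Rightarrow> ('n set \<Rightarrow> real) \<Rightarrow> real^'n^'n" where
  "laplacian E w = degree_matrix E w - adjacency_matrix E w"

definition signless_laplacian :: "'n::finite set set \<Rightarrow> ('n set \<Rightarrow> real) \<Rightarrow> real^'n^'n" where
  "signless_laplacian E w = degree_matrix E w + adjacency_matrix E w"

text \<open>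
  The library's multiplication and power on \<open>complex^'n^'n\<close> are entrywise, so \<open>exp\<close> is not
  available for the matrix product.
\<close>

definition matrix_exp :: "complex^'n^'n \<Rightarrow> complex^'n^'n" where
  "matrix_exp B = (\<Sum>k. (1 / fact k) *\<^sub>R (((**) B ^^ k) (mat 1)))"

abbreviation complex_matrix :: "real^'n^'m \<Rightarrow> complex^'n^'m" where
  "complex_matrix M \<equiv> map_matrix complex_of_real M"

definition transition_matrix :: "real^'n^'n \<Rightarrow> real \<Rightarrow> complex^'n^'n" where
  "transition_matrix M t = matrix_exp (map_matrix ((*) (\<i> * complex_of_real t)) (complex_matrix M))"

definition eigenpair :: "real^'n^'n \<Rightarrow> complex^'n \<Rightarrow> complex \<Rightarrow> bool" where
  "eigenpair M v \<theta> \<longleftrightarrow> v \<noteq> 0 \<and> complex_matrix M *v v = \<theta> *s v"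

definition spectrum :: "real^'n^'n \<Rightarrow> complex set" where
  "spectrum M = {\<theta>. \<exists>v. eigenpair M v \<theta>}"

definition eigenspace :: "real^'n^'n \<Rightarrow> complex \<Rightarrow> (complex^'n) set" where
  "eigenspace M \<theta> = {v. complex_matrix M *v v = \<theta> *s v}"

text \<open>
  Orthogonality is with respect to the Hermitian inner product of \<open>complex^'n\<close>; the library's
  \<open>inner\<close> is only its real part.
\<close>

definition orth_proj :: "(complex^'n) set \<Rightarrow> complex^'n \<Rightarrow> complex^'n" where
  "orth_proj S x = (THE y. y \<in> S \<and> (\<forall>z\<in>S. (\<Sum>i\<in>UNIV. (x - y) $ i * cnj (z $ i)) = 0))"

definition eigenprojection :: "real^'n^'n \<Rightarrow> complex \<Rightarrow> complex^'n \<Rightarrow> complex^'n" where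
  "eigenprojection M \<theta> = orth_proj (eigenspace M \<theta>)"

definition eigenvalue_support :: "real^'n^'n \<Rightarrow> complex^'n \<Rightarrow> complex set" where
  "eigenvalue_support M x = {\<theta> \<in> spectrum M. eigenprojection M \<theta> x \<noteq> 0}"

abbreviation char_vec :: "'n \<Rightarrow> complex^'n::finite" where
  "char_vec u \<equiv> axis u 1"

text \<open>The product of vectors is entrywise, and \<open>vec 1\<close> is the all-ones vector.\<close>

definition local_eps_uniform_mixing :: "real^'n^'n \<Rightarrow> 'n \<Rightarrow> bool" where
  "local_eps_uniform_mixing M u \<longleftrightarrow>
     (\<forall>\<epsilon>>0. \<exists>\<tau>::real.
        norm ((transition_matrix M \<tau> *v char_vec u) *
              (map_matrix cnj (transition_matrix M \<tau>) *v char_vec u)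
              - (1 / of_nat CARD('n)) *s vec 1) < \<epsilon>)"

end

theory Submission
  imports Defs
begin

text \<open>
  A real symmetric \<open>M\<close> has real spectrum and \<open>U(t) = \<Sum>\<^sub>\<theta> e\<^bsup>i t \<theta>\<^esup> E\<^sub>\<theta>\<close>, so \<open>U(t)\<close> is unitary. Hence the vectors
  \<open>\<surd>n U(\<tau>\<^sub>m) e\<^sub>u\<close> lie on a sphere, and compactness turns (1) into (2). Applying the continuous map
  \<open>E\<^sub>\<theta>\<close> to (2) gives \<open>e\<^bsup>i \<tau>\<^sub>m \<theta>\<^esup> \<surd>n E\<^sub>\<theta> e\<^sub>u \<longrightarrow> E\<^sub>\<theta> \<mu>\<close>, and as \<open>E\<^sub>\<theta> e\<^sub>u \<noteq> 0\<close> the scalars converge.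
  Conversely, (3) gives \<open>\<surd>n U(\<tau>\<^sub>m) e\<^sub>u \<longrightarrow> \<nu>\<close> where \<open>\<nu>\<close> is the orthogonal projection of \<open>\<mu>\<close> onto
  the sum of the eigenspaces in the support; both \<open>\<mu>\<close> and \<open>\<nu>\<close> have norm \<open>\<surd>n\<close>, so \<open>\<mu> = \<nu>\<close>. The
  version with eigenpairs uses \<open>v\<^sup>T\<close> without conjugation, which is harmless because the eigenspaces
  of a real matrix at real eigenvalues are closed under conjugation.
\<close>

section \<open>Eigenvectors of self-adjoint maps\<close>

lemma selfadjoint_invariant_subspace_has_eigenvector:
  fixes T :: "'a::euclidean_space \<Rightarrow> 'a"
  assumes lin: "linear T" and sa: "\<And>x y. T x \<bullet> y = x \<bullet> T y"
    and sub: "subspace W" and inv: "\<And>x. x \<in> W \<Longrightarrow> T x \<in> W" and nz: "W \<noteq> {0}"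
  obtains x a where "x \<in> W" "x \<noteq> 0" "T x = a *\<^sub>R x"
proof -
  txt \<open>A maximiser of the Rayleigh quotient on \<open>W\<close> is an eigenvector.\<close>
  let ?S = "W \<inter> sphere 0 1"
  obtain z where z: "z \<in> W" "z \<noteq> 0"
    using nz subspace_0[OF sub] by blast
  have "(1 / norm z) *\<^sub>R z \<in> ?S"
    using z sub by (simp add: subspace_scale)
  then have "?S \<noteq> {}" by blast
  moreover have "compact ?S"
    by (simp add: closed_Int_compact closed_subspace sub)
  moreover have "continuous_on ?S (\<lambda>x. T x \<bullet> x)"
    by (intro continuous_intros linear_continuous_on linear_conv_bounded_linear[THEN iffD1] lin)
  ultimately obtain x where x: "x \<in> ?S" and max: "\<And>y. y \<in> ?S \<Longrightarrow> T y \<bullet> y \<le> T x \<bullet> x"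
    using continuous_attains_sup[of ?S "\<lambda>x. T x \<bullet> x"] by blast
  define a where "a = T x \<bullet> x"
  have xx: "x \<bullet> x = 1" and xW: "x \<in> W" using x by (auto simp: norm_eq_1)
  \<comment> \<open>By homogeneity the bound on the unit sphere becomes a quadratic form that is
    nonnegative on all of \<open>W\<close>; it vanishes at \<open>x\<close>.\<close>
  have q: "0 \<le> a * (y \<bullet> y) - T y \<bullet> y" if y: "y \<in> W" for y
  proof (cases "y = 0")
    case True then show ?thesis by simp
  next
    case False
    have "T ((1 / norm y) *\<^sub>R y) \<bullet> ((1 / norm y) *\<^sub>R y) \<le> a"
      unfolding a_def by (rule max) (use y False sub in \<open>simp add: subspace_scale\<close>)
    then have "(T y \<bullet> y) / (y \<bullet> y) \<le> a"
      by (simp add: linear_scale[OF lin] dot_square_norm power2_eq_square)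
    then show ?thesis
      using False by (simp add: divide_le_eq)
  qed
  \<comment> \<open>The residual of the eigenvalue equation is half the gradient of this form at
    \<open>x\<close>; it has to vanish.\<close>
  define y where "y = a *\<^sub>R x - T x"
  have yW: "y \<in> W"
    unfolding y_def by (simp add: xW inv sub subspace_diff subspace_scale)
  define b where "b = a * (y \<bullet> y) - T y \<bullet> y"
  have b: "0 \<le> b" using q[OF yW] by (simp add: b_def)
  have c: "T y \<bullet> x = T x \<bullet> y" "y \<bullet> x = x \<bullet> y"
    by (metis sa inner_commute)+
  \<comment> \<open>The form along the line \<open>x + t y\<close>: its constant term is zero, so
    its linear term would make it negative for small negative \<open>t\<close> unless
    \<open>y\<close> is zero.\<close>
  have "0 \<le> 2 * t * (y \<bullet> y) + t\<^sup>2 * b" for t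
  proof -
    have "a * ((x + t *\<^sub>R y) \<bullet> (x + t *\<^sub>R y)) - T (x + t *\<^sub>R y) \<bullet> (x + t *\<^sub>R y)
        = (a * (x \<bullet> x) - T x \<bullet> x) + 2 * t * (a * (x \<bullet> y) - T x \<bullet> y) + t\<^sup>2 * b"
      by (simp add: b_def linear_add[OF lin] linear_scale[OF lin] inner_add_left inner_add_right
          c power2_eq_square algebra_simps)
    also have "\<dots> = 2 * t * (y \<bullet> y) + t\<^sup>2 * b"
      by (simp add: xx a_def) (simp add: y_def a_def inner_diff_left)
    finally show ?thesis
      using q[of "x + t *\<^sub>R y"] xW yW sub by (simp add: subspace_add subspace_scale)
  qed
  \<comment> \<open>For positive \<open>b\<close> the minimum is at
    \<open>t = - (y \<bullet> y) / b\<close>; the denominator \<open>b + 1\<close> also covers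
    \<open>b = 0\<close> and still yields the negative factor \<open>- b - 2\<close>.\<close>
  from this[of "- ((y \<bullet> y) / (b + 1))"]
  have "0 \<le> 2 * (- ((y \<bullet> y) / (b + 1))) * (y \<bullet> y) + (- ((y \<bullet> y) / (b + 1)))\<^sup>2 * b" .
  also have "\<dots> = (y \<bullet> y)\<^sup>2 * (b - 2 * (b + 1)) / (b + 1)\<^sup>2"
  proof -
    have "b + 1 \<noteq> 0" using b by simp
    then show ?thesis by (simp add: divide_simps power2_eq_square) (simp add: algebra_simps)
  qed
  finally have "0 \<le> (y \<bullet> y)\<^sup>2 * (b - 2 * (b + 1)) / (b + 1)\<^sup>2" .
  then have "0 \<le> (y \<bullet> y)\<^sup>2 * (b - 2 * (b + 1))"
    using b by (simp add: zero_le_divide_iff)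
  then have "y \<bullet> y = 0"
    using b by (simp add: zero_le_mult_iff)
  then show thesis
    using that[of x a] xW xx by (fastforce simp: y_def)
qed

section \<open>Hermitian orthogonality and eigenprojections\<close>

definition hermitian_inner :: "complex^'n \<Rightarrow> complex^'n \<Rightarrow> complex" where
  "hermitian_inner x y = (\<Sum>i\<in>UNIV. x $ i * cnj (y $ i))"

lemma Re_hermitian_inner: "Re (hermitian_inner x y) = x \<bullet> y"
  by (simp add: hermitian_inner_def inner_vec_def inner_complex_def)

text \<open>Multiplying the second argument by \<open>\<i>\<close> turns the imaginary part into a
  real part, so both parts become real inner products.\<close>

lemma Im_hermitian_inner: "Im (hermitian_inner x y) = x \<bullet> (\<i> *s y)"
  by (simp add: hermitian_inner_def inner_vec_def inner_complex_def)

lemma inner_smult_smult: "(c *s x) \<bullet> (d *s x) = Re (c * cnj d) * (norm x)\<^sup>2" for x :: "complex^'n"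
proof -
  have "(c * z) \<bullet> (d * z) = Re (c * cnj d) * (z \<bullet> z)" for z
    by (simp add: inner_complex_def algebra_simps)
  then show ?thesis
    by (simp add: inner_vec_def power2_norm_eq_inner sum_distrib_left)
qed

lemma inner_smult_right: "x \<bullet> (c *s y) = (cnj c *s x) \<bullet> y" for x y :: "complex^'n"
  by (simp add: inner_vec_def inner_complex_def algebra_simps)

lemma norm_smult: "norm (c *s x) = cmod c * norm x" for x :: "complex^'n"
proof -
  have "(norm (c *s x))\<^sup>2 = (cmod c * norm x)\<^sup>2"
    unfolding power2_norm_eq_inner inner_smult_smult
    by (simp add: power_mult_distrib cmod_power2 power2_norm_eq_inner[symmetric])
      (simp add: power2_eq_square)
  then show ?thesis
    by (simp add: power2_eq_iff_nonneg)
qed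

lemma of_real_smult: "complex_of_real a *s x = a *\<^sub>R x"
  unfolding vec_eq_iff by (simp add: scaleR_conv_of_real[where 'a = complex])

text \<open>A complex subspace is handled as a real one that is closed under multiplication by
  \<open>\<i>\<close>: on such sets Hermitian and real orthogonality coincide.\<close>

lemma hermitian_orthogonal_iff:
  assumes "\<And>z. z \<in> S \<Longrightarrow> \<i> *s z \<in> S"
  shows "(\<forall>z\<in>S. hermitian_inner x z = 0) \<longleftrightarrow> (\<forall>z\<in>S. x \<bullet> z = 0)"
  unfolding complex_eq_iff Re_hermitian_inner Im_hermitian_inner zero_complex.sel
  using assms by blast

lemma orth_proj_eqI:
  fixes S :: "(complex^'n) set"
  assumes S: "subspace S" "\<And>z. z \<in> S \<Longrightarrow> \<i> *s z \<in> S"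
    and y: "y \<in> S" "\<And>z. z \<in> S \<Longrightarrow> (x - y) \<bullet> z = 0"
  shows "orth_proj S x = y"
proof -
  have "orth_proj S x = (THE y. y \<in> S \<and> (\<forall>z\<in>S. (x - y) \<bullet> z = 0))"
    by (simp only: orth_proj_def hermitian_inner_def[symmetric] hermitian_orthogonal_iff[OF S(2)])
  also have "\<dots> = y"
  proof (rule the_equality)
    fix y' assume y': "y' \<in> S \<and> (\<forall>z\<in>S. (x - y') \<bullet> z = 0)"
    then have mem: "y' - y \<in> S"
      using y S by (simp only: subspace_diff)
    \<comment> \<open>The difference of two candidates lies in \<open>S\<close> and is orthogonal to
      \<open>S\<close>, hence to itself.\<close>
    have "(y' - y) \<bullet> (y' - y) = (x - y) \<bullet> (y' - y) - (x - y') \<bullet> (y' - y)"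
      by (simp add: inner_diff_left)
    also have "\<dots> = 0"
      using y(2)[OF mem] y' mem by simp
    finally show "y' = y" by simp
  qed (use y in blast)
  finally show ?thesis .
qed

text \<open>Existence comes from the real orthogonal decomposition; by the uniqueness just proved,
  its component in \<open>S\<close> is the value of the definite description.\<close>

lemma orth_proj_properties:
  fixes S :: "(complex^'n) set"
  assumes S: "subspace S" "\<And>z. z \<in> S \<Longrightarrow> \<i> *s z \<in> S"
  shows "orth_proj S x \<in> S" "z \<in> S \<Longrightarrow> (x - orth_proj S x) \<bullet> z = 0"
proof -
  obtain y w where "y \<in> S" "\<And>z. z \<in> S \<Longrightarrow> orthogonal w z" "x = y + w"
    using orthogonal_subspace_decomp_exists[of S x] S by (auto simp: span_eq_iff[THEN iffD2])
  moreover from this have "orth_proj S x = y"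
    by (intro orth_proj_eqI S) (simp_all add: orthogonal_def)
  ultimately show "orth_proj S x \<in> S" "z \<in> S \<Longrightarrow> (x - orth_proj S x) \<bullet> z = 0"
    by (auto simp: orthogonal_def)
qed

section \<open>Eigenspaces and their projections\<close>

lemma smult_eigenspace: "v \<in> eigenspace M \<theta> \<Longrightarrow> c *s v \<in> eigenspace M \<theta>"
  by (simp add: eigenspace_def vector_scalar_commute vector_smult_assoc mult.commute)

lemma subspace_eigenspace: "subspace (eigenspace M \<theta>)"
proof (rule subspaceI)
  fix x c assume "x \<in> eigenspace M \<theta>"
  then show "c *\<^sub>R x \<in> eigenspace M \<theta>"
    by (metis of_real_smult smult_eigenspace)
qed (auto simp: eigenspace_def matrix_vector_right_distrib vector_add_ldistrib)

lemma eigenprojection_eqI: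
  assumes "y \<in> eigenspace M \<theta>" "\<And>z. z \<in> eigenspace M \<theta> \<Longrightarrow> (x - y) \<bullet> z = 0"
  shows "eigenprojection M \<theta> x = y"
  unfolding eigenprojection_def
  by (rule orth_proj_eqI) (use assms in \<open>auto simp: subspace_eigenspace smult_eigenspace\<close>)

lemma eigenprojection_in_eigenspace: "eigenprojection M \<theta> x \<in> eigenspace M \<theta>"
  unfolding eigenprojection_def
  by (rule orth_proj_properties) (auto simp: subspace_eigenspace smult_eigenspace)

lemma eigenprojection_orthogonal:
  "z \<in> eigenspace M \<theta> \<Longrightarrow> (x - eigenprojection M \<theta> x) \<bullet> z = 0"
  unfolding eigenprojection_def
  by (rule orth_proj_properties) (auto simp: subspace_eigenspace smult_eigenspace)

lemma eigenprojection_smult: "eigenprojection M \<theta> (c *s x) = c *s eigenprojection M \<theta> x"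
proof (rule eigenprojection_eqI)
  fix z assume "z \<in> eigenspace M \<theta>"
  \<comment> \<open>A scalar crosses the real inner product as its conjugate, so the test vector
    becomes \<open>cnj c *s z\<close>, again in the eigenspace.\<close>
  then have "(x - eigenprojection M \<theta> x) \<bullet> (cnj c *s z) = 0"
    by (intro eigenprojection_orthogonal smult_eigenspace)
  then show "(c *s x - c *s eigenprojection M \<theta> x) \<bullet> z = 0"
    by (simp add: inner_smult_right vector_ssub_ldistrib)
qed (simp add: smult_eigenspace eigenprojection_in_eigenspace)

lemma linear_eigenprojection: "linear (eigenprojection M \<theta>)"
proof (rule linearI)
  fix x y
  show "eigenprojection M \<theta> (x + y) = eigenprojection M \<theta> x + eigenprojection M \<theta> y"
  proof (rule eigenprojection_eqI)
    fix z assume "z \<in> eigenspace M \<theta>"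
    then have "(x - eigenprojection M \<theta> x) \<bullet> z + (y - eigenprojection M \<theta> y) \<bullet> z = 0"
      by (simp add: eigenprojection_orthogonal)
    then show "(x + y - (eigenprojection M \<theta> x + eigenprojection M \<theta> y)) \<bullet> z = 0"
      by (simp add: inner_diff_left inner_add_left)
  qed (simp add: subspace_add subspace_eigenspace eigenprojection_in_eigenspace)
next
  fix r x
  show "eigenprojection M \<theta> (r *\<^sub>R x) = r *\<^sub>R eigenprojection M \<theta> x"
    using eigenprojection_smult[of M \<theta> "complex_of_real r" x] by (simp add: of_real_smult)
qed

lemma eigenprojection_eq_iff:
  "eigenprojection M \<theta> x = eigenprojection M \<theta> y \<longleftrightarrow>
    (\<forall>z\<in>eigenspace M \<theta>. hermitian_inner (x - y) z = 0)"
proof -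
  have "eigenprojection M \<theta> x = eigenprojection M \<theta> y \<longleftrightarrow> eigenprojection M \<theta> (x - y) = 0"
    by (simp add: linear_diff[OF linear_eigenprojection])
  also have "\<dots> \<longleftrightarrow> (\<forall>z\<in>eigenspace M \<theta>. (x - y) \<bullet> z = 0)"
    using eigenprojection_orthogonal[of _ M \<theta> "x - y"]
    by (auto intro!: eigenprojection_eqI simp: subspace_0 subspace_eigenspace)
  finally show ?thesis
    by (simp add: hermitian_orthogonal_iff smult_eigenspace)
qed

section \<open>Spectral decomposition of real symmetric matrices\<close>

lemma complex_matrix_selfadjoint:
  fixes M :: "real^'n^'n"
  assumes "transpose M = M"
  shows "(complex_matrix M *v x) \<bullet> y = x \<bullet> (complex_matrix M *v y)"
proof -
  have sym: "M $ i $ j = M $ j $ i" for i j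
    using arg_cong[OF assms, of "\<lambda>A. A $ i $ j"] by (simp add: transpose_def)
  have mul: "(complex_of_real a * z) \<bullet> w = a * (z \<bullet> w)"
    "w \<bullet> (complex_of_real a * z) = a * (w \<bullet> z)" for a z w
    by (auto simp: inner_complex_def algebra_simps)
  have "(complex_matrix M *v x) \<bullet> y = (\<Sum>i\<in>UNIV. \<Sum>j\<in>UNIV. M $ i $ j * (x $ j \<bullet> y $ i))"
    by (simp add: inner_vec_def matrix_vector_mult_def inner_sum_left mul)
  also have "\<dots> = (\<Sum>j\<in>UNIV. \<Sum>i\<in>UNIV. M $ i $ j * (x $ j \<bullet> y $ i))"
    by (rule sum.swap)
  also have "\<dots> = x \<bullet> (complex_matrix M *v y)"
    by (simp add: inner_vec_def matrix_vector_mult_def inner_sum_right mul sym)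
  finally show ?thesis .
qed

lemma eigenvalue_real:
  fixes M :: "real^'n^'n"
  assumes "transpose M = M" "\<theta> \<in> spectrum M"
  shows "\<theta> = complex_of_real (Re \<theta>)"
proof -
  obtain v where v: "v \<noteq> 0" "complex_matrix M *v v = \<theta> *s v"
    using assms by (auto simp: spectrum_def eigenpair_def)
  \<comment> \<open>Self-adjointness tested on \<open>v\<close> and \<open>\<i> *s v\<close>: the
    two sides are \<open>Im \<theta>\<close> and \<open>- Im \<theta>\<close> times the squared norm
    of \<open>v\<close>.\<close>
  have "(\<theta> *s v) \<bullet> (\<i> *s v) = (1 *s v) \<bullet> ((\<i> * \<theta>) *s v)"
    using complex_matrix_selfadjoint[OF assms(1), of v "\<i> *s v"]
    by (simp add: v vector_scalar_commute vector_smult_assoc)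
  then have "Im \<theta> = 0"
    using v by (simp only: inner_smult_smult) simp
  then show ?thesis by (simp add: complex_eq_iff)
qed

lemma in_spectrumI: "v \<in> eigenspace M \<theta> \<Longrightarrow> v \<noteq> 0 \<Longrightarrow> \<theta> \<in> spectrum M"
  by (auto simp: spectrum_def eigenpair_def eigenspace_def)

text \<open>Moving \<open>M\<close> across the inner product multiplies it by \<theta> on one side
  and by \<eta> on the other. Zero vectors are split off because only a nonzero vector puts its
  parameter in the spectrum, where it is real.\<close>

lemma eigenspaces_orthogonal:
  fixes M :: "real^'n^'n"
  assumes sym: "transpose M = M" and v: "v \<in> eigenspace M \<theta>" and w: "w \<in> eigenspace M \<eta>"
    and ne: "\<theta> \<noteq> \<eta>"
  shows "v \<bullet> w = 0"
proof (cases "v = 0 \<or> w = 0")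
  case False
  have re: "\<theta> = complex_of_real (Re \<theta>)" "\<eta> = complex_of_real (Re \<eta>)"
    using eigenvalue_real[OF sym] v w False by (meson in_spectrumI)+
  then have "complex_matrix M *v v = Re \<theta> *\<^sub>R v" "complex_matrix M *v w = Re \<eta> *\<^sub>R w"
    using v w by (metis (mono_tags) eigenspace_def mem_Collect_eq of_real_smult)+
  then have "Re \<theta> * (v \<bullet> w) = Re \<eta> * (v \<bullet> w)"
    using complex_matrix_selfadjoint[OF sym, of v w] by simp
  then show ?thesis using re ne by auto
qed auto

text \<open>One eigenvector per eigenvalue gives an orthogonal, hence independent, family in a
  finite-dimensional space.\<close>

lemma finite_spectrum:
  fixes M :: "real^'n^'n"
  assumes sym: "transpose M = M"
  shows "finite (spectrum M)"
proof -
  have "\<forall>\<theta>\<in>spectrum M. \<exists>v. v \<noteq> 0 \<and> v \<in> eigenspace M \<theta>"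
    by (auto simp: spectrum_def eigenpair_def eigenspace_def)
  then obtain f where f: "\<And>\<theta>. \<theta> \<in> spectrum M \<Longrightarrow> f \<theta> \<noteq> 0 \<and> f \<theta> \<in> eigenspace M \<theta>"
    by metis
  have orth: "f \<theta> \<bullet> f \<eta> = 0" if "\<theta> \<in> spectrum M" "\<eta> \<in> spectrum M" "\<theta> \<noteq> \<eta>" for \<theta> \<eta>
    using that f eigenspaces_orthogonal[OF sym] by blast
  then have "inj_on f (spectrum M)"
    by (intro inj_onI) (metis f inner_eq_zero_iff)
  moreover have "independent (f ` spectrum M)"
    by (rule pairwise_orthogonal_independent)
      (use f orth in \<open>auto simp: pairwise_def orthogonal_def\<close>)
  ultimately show ?thesis
    using independent_imp_finite finite_imageD by blast
qed

text \<open>The vectors orthogonal to every eigenspace form an invariant subspace \<open>W\<close>.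
  If nonzero, it would contain an eigenvector, which would be orthogonal to itself. The remainder of
  \<open>x\<close> after subtracting its projections lies in \<open>W\<close>.\<close>

lemma sum_eigenprojections:
  fixes M :: "real^'n^'n"
  assumes sym: "transpose M = M"
  shows "(\<Sum>\<theta>\<in>spectrum M. eigenprojection M \<theta> x) = x"
proof -
  define W where "W = {x. \<forall>\<theta>. \<forall>v\<in>eigenspace M \<theta>. x \<bullet> v = 0}"
  have W0: "W = {0}"
  proof (rule ccontr)
    assume "W \<noteq> {0}"
    moreover have "subspace W"
      by (auto simp: W_def subspace_def inner_add_left)
    moreover have "complex_matrix M *v x \<in> W" if "x \<in> W" for x
      unfolding W_def
    proof (intro CollectI allI ballI)
      fix \<theta> v assume v: "v \<in> eigenspace M \<theta>"
      have "(complex_matrix M *v x) \<bullet> v = x \<bullet> (\<theta> *s v)"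
        using v by (simp add: complex_matrix_selfadjoint[OF sym] eigenspace_def)
      also have "\<dots> = 0"
        using that smult_eigenspace[OF v] by (auto simp: W_def)
      finally show "(complex_matrix M *v x) \<bullet> v = 0" .
    qed
    ultimately obtain v a where v: "v \<in> W" "v \<noteq> 0" "complex_matrix M *v v = a *\<^sub>R v"
      using selfadjoint_invariant_subspace_has_eigenvector[of "\<lambda>x. complex_matrix M *v x" W]
        complex_matrix_selfadjoint[OF sym] by (metis matrix_vector_mul_linear)
    then have "v \<in> eigenspace M (complex_of_real a)"
      by (simp add: eigenspace_def of_real_smult)
    then have "v \<bullet> v = 0" using v by (auto simp: W_def)
    then show False using v by simp
  qed
  have "x - (\<Sum>\<theta>\<in>spectrum M. eigenprojection M \<theta> x) \<in> W"
    unfolding W_def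
  proof (intro CollectI allI ballI)
    fix \<theta> v assume v: "v \<in> eigenspace M \<theta>"
    show "(x - (\<Sum>\<theta>\<in>spectrum M. eigenprojection M \<theta> x)) \<bullet> v = 0"
    proof (cases "v = 0")
      case False
      then have "\<theta> \<in> spectrum M" using v in_spectrumI by blast
      have "(\<Sum>\<eta>\<in>spectrum M. eigenprojection M \<eta> x) \<bullet> v
          = (\<Sum>\<eta>\<in>spectrum M. if \<eta> = \<theta> then eigenprojection M \<theta> x \<bullet> v else 0)"
        unfolding inner_sum_left
        by (intro sum.cong refl)
          (auto intro: eigenspaces_orthogonal[OF sym eigenprojection_in_eigenspace v])
      also have "\<dots> = x \<bullet> v"
        using eigenprojection_orthogonal[OF v, of x] \<open>\<theta> \<in> spectrum M\<close> finite_spectrum[OF sym]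
        by (simp add: inner_diff_left)
      finally show ?thesis by (simp add: inner_diff_left)
    qed simp
  qed
  then show ?thesis using W0 by simp
qed

section \<open>The transition matrix\<close>

text \<open>The product is bounded bilinear with some constant \<open>K\<close>, which gives a
  comparison with the scalar exponential series at \<open>K * norm B\<close>.\<close>

lemma summable_matrix_exp: "summable (\<lambda>k. (1 / fact k) *\<^sub>R (((**) B ^^ k) (mat 1)))"
  for B :: "complex^'n^'n"
proof -
  have "bilinear ((**) :: complex^'n^'n \<Rightarrow> complex^'n^'n \<Rightarrow> complex^'n^'n)"
    unfolding bilinear_def
    by (auto intro!: linearI simp: matrix_matrix_mult_def vec_eq_iff algebra_simps sum.distrib
        scaleR_sum_right)
  from bilinear_bounded_pos[OF this]
  obtain K where K: "0 < K" "\<And>(A :: complex^'n^'n) (C :: complex^'n^'n). norm (A ** C) \<le> K * norm A * norm C"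
    by blast
  have "norm (((**) B ^^ k) (mat 1)) \<le> (K * norm B) ^ k * norm (mat 1 :: complex^'n^'n)" for k
  proof (induction k)
    case (Suc k)
    have "norm (B ** ((**) B ^^ k) (mat 1)) \<le> K * norm B * norm (((**) B ^^ k) (mat 1))"
      by (rule K)
    also have "\<dots> \<le> K * norm B * ((K * norm B) ^ k * norm (mat 1 :: complex^'n^'n))"
      using Suc K by (intro mult_left_mono) auto
    finally show ?case by (simp add: mult_ac)
  qed simp
  then have "norm ((1 / fact k) *\<^sub>R (((**) B ^^ k) (mat 1)))
      \<le> (inverse (fact k) * (K * norm B) ^ k) * norm (mat 1 :: complex^'n^'n)" for k
    by (simp add: field_simps)
  then show ?thesis
    by (intro summable_comparison_test'[OF summable_mult2[OF summable_exp]]) auto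
qed

text \<open>Applying a matrix to \<open>v\<close> is bounded linear and so passes through the
  series, where powers of \<open>B\<close> act on \<open>v\<close> as powers of
  \<open>c\<close>.\<close>

lemma matrix_exp_eigenvector:
  fixes B :: "complex^'n^'n"
  assumes v: "B *v v = c *s v"
  shows "matrix_exp B *v v = exp c *s v"
proof -
  have lin: "bounded_linear (\<lambda>A::complex^'n^'n. A *v v)"
    unfolding linear_conv_bounded_linear[symmetric]
    by (auto intro!: linearI simp: matrix_vector_mult_def vec_eq_iff algebra_simps sum.distrib
        scaleR_sum_right)
  have lin2: "bounded_linear (\<lambda>z::complex. z *s v)"
    unfolding linear_conv_bounded_linear[symmetric]
    by (auto intro!: linearI simp: vec_eq_iff algebra_simps)
  have pow: "((**) B ^^ k) (mat 1) *v v = c ^ k *s v" for k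
    by (induction k)
      (auto simp: matrix_vector_mul_assoc[symmetric] v vector_scalar_commute vector_smult_assoc mult.commute)
  have "matrix_exp B *v v = (\<Sum>k. ((1 / fact k) *\<^sub>R (((**) B ^^ k) (mat 1))) *v v)"
    unfolding matrix_exp_def by (rule bounded_linear.suminf[OF lin summable_matrix_exp])
  also have "\<dots> = (\<Sum>k. (c ^ k /\<^sub>R fact k) *s v)"
    by (intro arg_cong[where f = suminf] ext)
      (simp add: linear_scale[OF bounded_linear.linear[OF lin]] pow, simp add: vec_eq_iff divide_inverse)
  also have "\<dots> = exp c *s v"
    unfolding exp_def by (rule bounded_linear.suminf[OF lin2 summable_exp_generic, symmetric])
  finally show ?thesis .
qed

lemma transition_matrix_eigenvector:
  assumes "v \<in> eigenspace M \<theta>"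
  shows "transition_matrix M t *v v = exp (\<i> * complex_of_real t * \<theta>) *s v"
  unfolding transition_matrix_def
proof (rule matrix_exp_eigenvector)
  have "map_matrix ((*) (\<i> * complex_of_real t)) (complex_matrix M) *v v
      = (\<i> * complex_of_real t) *s (complex_matrix M *v v)"
    by (simp add: matrix_vector_mult_def vec_eq_iff sum_distrib_left mult.assoc)
  then show "map_matrix ((*) (\<i> * complex_of_real t)) (complex_matrix M) *v v
      = (\<i> * complex_of_real t * \<theta>) *s v"
    using assms by (simp add: eigenspace_def vector_smult_assoc)
qed

lemma transition_matrix_spectral:
  fixes M :: "real^'n^'n"
  assumes sym: "transpose M = M"
  shows "transition_matrix M t *v x =
    (\<Sum>\<theta>\<in>spectrum M. exp (\<i> * complex_of_real t * \<theta>) *s eigenprojection M \<theta> x)"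
proof -
  have "transition_matrix M t *v (\<Sum>\<theta>\<in>spectrum M. eigenprojection M \<theta> x)
      = (\<Sum>\<theta>\<in>spectrum M. transition_matrix M t *v eigenprojection M \<theta> x)"
    by (rule linear_sum) simp
  then show ?thesis
    by (simp add: sum_eigenprojections[OF sym]
        transition_matrix_eigenvector[OF eigenprojection_in_eigenspace])
qed

text \<open>Orthogonality removes every other summand. The index set is general because both the
  spectrum and the eigenvalue support are used for it.\<close>

lemma eigenprojection_sum_eigenvectors:
  fixes M :: "real^'n^'n"
  assumes sym: "transpose M = M" and S: "finite S" "\<theta> \<in> S"
    and f: "\<And>\<eta>. \<eta> \<in> S \<Longrightarrow> f \<eta> \<in> eigenspace M \<eta>"
  shows "eigenprojection M \<theta> (\<Sum>\<eta>\<in>S. f \<eta>) = f \<theta>"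
proof (rule eigenprojection_eqI)
  fix z assume z: "z \<in> eigenspace M \<theta>"
  have "(\<Sum>\<eta>\<in>S. f \<eta>) \<bullet> z = (\<Sum>\<eta>\<in>S. if \<eta> = \<theta> then f \<theta> \<bullet> z else 0)"
    unfolding inner_sum_left
    by (intro sum.cong refl) (auto intro: eigenspaces_orthogonal[OF sym f z])
  then show "((\<Sum>\<eta>\<in>S. f \<eta>) - f \<theta>) \<bullet> z = 0"
    using S by (simp add: inner_diff_left)
qed (use f S in auto)

lemma norm_transition_matrix_mult:
  fixes M :: "real^'n^'n"
  assumes sym: "transpose M = M"
  shows "norm (transition_matrix M t *v x) = norm x"
proof -
  \<comment> \<open>Arbitrary coefficients let one identity serve twice: exponentials give the norm
    of the evolved vector, ones give that of \<open>x\<close>. The exponentials have modulus 1 as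
    the eigenvalues are real.\<close>
  have pyth: "(norm (\<Sum>\<theta>\<in>spectrum M. c \<theta> *s eigenprojection M \<theta> x))\<^sup>2
      = (\<Sum>\<theta>\<in>spectrum M. (cmod (c \<theta>) * norm (eigenprojection M \<theta> x))\<^sup>2)" for c
    by (subst norm_sum_Pythagorean)
      (auto simp: finite_spectrum[OF sym] norm_smult pairwise_def orthogonal_def
        intro: eigenspaces_orthogonal[OF sym] smult_eigenspace eigenprojection_in_eigenspace)
  have im: "Im \<theta> = 0" if "\<theta> \<in> spectrum M" for \<theta>
    using eigenvalue_real[OF sym that] by (simp add: complex_eq_iff)
  have "(norm (transition_matrix M t *v x))\<^sup>2 = (norm x)\<^sup>2"
    using pyth[of "\<lambda>\<theta>. exp (\<i> * complex_of_real t * \<theta>)"] pyth[of "\<lambda>_. 1"]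
    by (simp add: transition_matrix_spectral[OF sym] im sum_eigenprojections[OF sym])
  then show ?thesis by (simp add: power2_eq_iff_nonneg)
qed


section \<open>Conjugation and transposed products\<close>

lemma conj_in_eigenspace:
  assumes "v \<in> eigenspace M \<theta>"
  shows "(\<chi> i. cnj (v $ i)) \<in> eigenspace M (cnj \<theta>)"
proof -
  have "cnj ((complex_matrix M *v v) $ i) = cnj ((\<theta> *s v) $ i)" for i
    using assms by (simp add: eigenspace_def)
  then show ?thesis
    by (simp add: eigenspace_def vec_eq_iff matrix_vector_mult_def)
qed

text \<open>A transposed product with \<open>v\<close> is a Hermitian product with the conjugate of
  \<open>v\<close>, and conjugation is an involution of the eigenspace since \<theta> is
  real.\<close>

lemma eigenprojection_eq_iff_scalar_product:
  fixes M :: "real^'n^'n"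
  assumes sym: "transpose M = M" and "\<theta> \<in> spectrum M"
  shows "eigenprojection M \<theta> x = eigenprojection M \<theta> y \<longleftrightarrow>
    (\<forall>v\<in>eigenspace M \<theta>. scalar_product v x = scalar_product v y)"
proof -
  have [simp]: "cnj \<theta> = \<theta>"
    using eigenvalue_real[OF assms] by (metis complex_cnj_complex_of_real)
  have conj: "(\<chi> i. cnj (v $ i)) \<in> eigenspace M \<theta>" if "v \<in> eigenspace M \<theta>" for v
    using conj_in_eigenspace[OF that] by simp
  have herm: "hermitian_inner (x - y) (\<chi> i. cnj (v $ i)) = scalar_product v x - scalar_product v y" for v
    by (simp add: hermitian_inner_def scalar_product_def sum_subtractf[symmetric] algebra_simps)
  have "(\<forall>z\<in>eigenspace M \<theta>. hermitian_inner (x - y) z = 0) \<longleftrightarrow>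
      (\<forall>v\<in>eigenspace M \<theta>. hermitian_inner (x - y) (\<chi> i. cnj (v $ i)) = 0)"
  proof (intro iffI ballI)
    fix z assume "z \<in> eigenspace M \<theta>"
      and "\<forall>v\<in>eigenspace M \<theta>. hermitian_inner (x - y) (\<chi> i. cnj (v $ i)) = 0"
    then have "hermitian_inner (x - y) (\<chi> i. cnj ((\<chi> i. cnj (z $ i)) $ i)) = 0"
      using conj by blast
    then show "hermitian_inner (x - y) z = 0" by simp
  qed (use conj in blast)
  then show ?thesis
    by (simp add: eigenprojection_eq_iff herm)
qed

section \<open>Limits of evolved vectors\<close>

lemma tendsto_smult_left:
  fixes x :: "complex^'n"
  assumes "(f \<longlongrightarrow> a) F"
  shows "((\<lambda>m. f m *s x) \<longlongrightarrow> a *s x) F"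
  by (rule vec_tendstoI) (auto intro!: tendsto_intros assms)

text \<open>Dividing by a nonzero coordinate of \<open>x\<close> recovers the scalars. This is how
  convergence of the exponentials follows from that of the vectors.\<close>

lemma smult_tendstoD:
  fixes x y :: "complex^'n"
  assumes lim: "(\<lambda>m. f m *s x) \<longlonglongrightarrow> y" and "x \<noteq> 0"
  obtains a where "f \<longlonglongrightarrow> a" "a *s x = y"
proof -
  obtain i where i: "x $ i \<noteq> 0"
    using \<open>x \<noteq> 0\<close> by (auto simp: vec_eq_iff)
  have "(\<lambda>m. (f m * x $ i) / x $ i) \<longlonglongrightarrow> y $ i / x $ i"
    using tendsto_vec_nth[OF lim, of i] i by (intro tendsto_intros) auto
  then have f: "f \<longlonglongrightarrow> y $ i / x $ i"
    using i by simp
  with that LIMSEQ_unique[OF tendsto_smult_left[OF f] lim] show thesis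
    by blast
qed

text \<open>The right-hand side only constrains the components of \<mu> in the support of
  \<open>x\<close>; the norm hypothesis excludes any others.\<close>

lemma transition_limit_iff_eigenprojections:
  fixes M :: "real^'n^'n" and c :: complex
  assumes sym: "transpose M = M" and c: "c \<noteq> 0" and norm: "norm \<mu> = norm (c *s x)"
  shows "(\<lambda>m. c *s (transition_matrix M (\<tau> m) *v x)) \<longlonglongrightarrow> \<mu> \<longleftrightarrow>
    (\<forall>\<theta>\<in>eigenvalue_support M x.
       convergent (\<lambda>m. exp (\<i> * complex_of_real (\<tau> m) * \<theta>)) \<and>
       (lim (\<lambda>m. exp (\<i> * complex_of_real (\<tau> m) * \<theta>)) * c) *s eigenprojection M \<theta> x
         = eigenprojection M \<theta> \<mu>)"
    (is "?lim \<longleftrightarrow> (\<forall>\<theta>\<in>_. convergent (?e \<theta>) \<and> _ \<theta>)")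
proof
  assume lim: ?lim
  show "\<forall>\<theta>\<in>eigenvalue_support M x. convergent (?e \<theta>) \<and>
      (lim (?e \<theta>) * c) *s eigenprojection M \<theta> x = eigenprojection M \<theta> \<mu>"
  proof
    fix \<theta> assume "\<theta> \<in> eigenvalue_support M x"
    then have spec: "\<theta> \<in> spectrum M" and nz: "eigenprojection M \<theta> x \<noteq> 0"
      by (auto simp: eigenvalue_support_def)
    have "eigenprojection M \<theta> (transition_matrix M (\<tau> m) *v x) = ?e \<theta> m *s eigenprojection M \<theta> x" for m
      unfolding transition_matrix_spectral[OF sym]
      by (rule eigenprojection_sum_eigenvectors[OF sym finite_spectrum[OF sym] spec])
        (simp add: smult_eigenspace eigenprojection_in_eigenspace)
    moreover have "(\<lambda>m. eigenprojection M \<theta> (c *s (transition_matrix M (\<tau> m) *v x)))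
        \<longlonglongrightarrow> eigenprojection M \<theta> \<mu>"
      using linear_eigenprojection
      by (intro bounded_linear.tendsto[OF _ lim]) (simp add: linear_conv_bounded_linear)
    ultimately have "(\<lambda>m. ?e \<theta> m *s (c *s eigenprojection M \<theta> x)) \<longlonglongrightarrow> eigenprojection M \<theta> \<mu>"
      by (simp add: eigenprojection_smult vector_smult_assoc mult.commute)
    then obtain a where a: "?e \<theta> \<longlonglongrightarrow> a" "a *s (c *s eigenprojection M \<theta> x) = eigenprojection M \<theta> \<mu>"
      using c nz by (elim smult_tendstoD) auto
    then show "convergent (?e \<theta>) \<and>
      (lim (?e \<theta>) * c) *s eigenprojection M \<theta> x = eigenprojection M \<theta> \<mu>"
      using limI[OF a(1)] by (auto simp: convergent_def vector_smult_assoc)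
  qed
next
  assume H: "\<forall>\<theta>\<in>eigenvalue_support M x. convergent (?e \<theta>) \<and>
      (lim (?e \<theta>) * c) *s eigenprojection M \<theta> x = eigenprojection M \<theta> \<mu>"
  let ?P = "eigenvalue_support M x"
  have fin: "finite ?P"
    using finite_spectrum[OF sym] by (simp add: eigenvalue_support_def)
  define \<nu> where "\<nu> = (\<Sum>\<theta>\<in>?P. eigenprojection M \<theta> \<mu>)"
  \<comment> \<open>Summands outside the support vanish, so the finitely many convergent
    coefficients determine the limit.\<close>
  have expand: "c *s (transition_matrix M (\<tau> m) *v x)
      = (\<Sum>\<theta>\<in>?P. (?e \<theta> m * c) *s eigenprojection M \<theta> x)" for m
  proof -
    have "c *s (transition_matrix M (\<tau> m) *v x)
        = (\<Sum>\<theta>\<in>spectrum M. (?e \<theta> m * c) *s eigenprojection M \<theta> x)"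
      by (simp add: transition_matrix_spectral[OF sym] sum_cmul[symmetric] vector_smult_assoc mult.commute)
    also have "\<dots> = (\<Sum>\<theta>\<in>?P. (?e \<theta> m * c) *s eigenprojection M \<theta> x)"
      using finite_spectrum[OF sym]
      by (intro sum.mono_neutral_right) (auto simp: eigenvalue_support_def)
    finally show ?thesis .
  qed
  have "(\<lambda>m. \<Sum>\<theta>\<in>?P. (?e \<theta> m * c) *s eigenprojection M \<theta> x)
      \<longlonglongrightarrow> (\<Sum>\<theta>\<in>?P. (lim (?e \<theta>) * c) *s eigenprojection M \<theta> x)"
    using H by (intro tendsto_sum tendsto_smult_left tendsto_mult tendsto_const)
      (simp add: convergent_LIMSEQ_iff)
  then have lim: "(\<lambda>m. c *s (transition_matrix M (\<tau> m) *v x)) \<longlonglongrightarrow> \<nu>"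
    using H by (simp add: expand \<nu>_def)
  have "(\<lambda>m. norm (c *s (transition_matrix M (\<tau> m) *v x))) \<longlonglongrightarrow> norm \<nu>"
    by (intro tendsto_norm lim)
  then have "norm \<nu> = norm \<mu>"
    by (simp add: norm norm_smult norm_transition_matrix_mult[OF sym] LIMSEQ_const_iff)
  \<comment> \<open>With equal norms, this orthogonality forces \<mu> = \<nu>. It holds because
    \<mu> and \<nu> have the same projection at every \<theta> in the support.\<close>
  moreover have "(\<mu> - \<nu>) \<bullet> \<nu> = 0"
  proof -
    have "(\<mu> - \<nu>) \<bullet> eigenprojection M \<theta> \<mu> = 0" if "\<theta> \<in> ?P" for \<theta>
    proof -
      have "eigenprojection M \<theta> \<nu> = eigenprojection M \<theta> \<mu>"
        unfolding \<nu>_def using that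
        by (intro eigenprojection_sum_eigenvectors[OF sym fin]) (auto simp: eigenprojection_in_eigenspace)
      then have "eigenprojection M \<theta> (\<mu> - \<nu>) = 0"
        by (simp add: linear_diff[OF linear_eigenprojection])
      moreover have "(\<mu> - \<nu> - eigenprojection M \<theta> (\<mu> - \<nu>)) \<bullet> eigenprojection M \<theta> \<mu> = 0"
        by (rule eigenprojection_orthogonal[OF eigenprojection_in_eigenspace])
      ultimately show ?thesis by simp
    qed
    then show ?thesis
      by (subst (2) \<nu>_def) (simp add: inner_sum_right)
  qed
  moreover have "(\<mu> - \<nu>) \<bullet> (\<mu> - \<nu>) = \<mu> \<bullet> \<mu> - \<nu> \<bullet> \<nu> - 2 * ((\<mu> - \<nu>) \<bullet> \<nu>)"
    by (simp add: inner_diff_left inner_diff_right inner_commute)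
  ultimately have "(\<mu> - \<nu>) \<bullet> (\<mu> - \<nu>) = 0"
    by (simp add: dot_square_norm)
  then show ?lim
    using lim by simp
qed

lemma eigenprojections_iff_eigenpairs:
  fixes M :: "real^'n^'n" and c :: complex
  assumes sym: "transpose M = M"
  shows "(\<forall>\<theta>\<in>eigenvalue_support M x.
       convergent (\<lambda>m. exp (\<i> * complex_of_real (\<tau> m) * \<theta>)) \<and>
       (lim (\<lambda>m. exp (\<i> * complex_of_real (\<tau> m) * \<theta>)) * c) *s eigenprojection M \<theta> x
         = eigenprojection M \<theta> \<mu>) \<longleftrightarrow>
    (\<forall>v \<theta>. eigenpair M v \<theta> \<and> \<theta> \<in> eigenvalue_support M x \<longrightarrow>
       convergent (\<lambda>m. exp (\<i> * complex_of_real (\<tau> m) * \<theta>)) \<and>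
       lim (\<lambda>m. exp (\<i> * complex_of_real (\<tau> m) * \<theta>)) * c * scalar_product v x
         = scalar_product v \<mu>)"
    (is "(\<forall>\<theta>\<in>_. ?C \<theta> \<and> (?L \<theta> * c) *s _ \<theta> = _ \<theta>) \<longleftrightarrow> _")
proof -
  have sp: "scalar_product v (a *s y) = a * scalar_product v y" for v y :: "complex^'n" and a
    by (simp add: scalar_product_def sum_distrib_left mult_ac)
  have sp0: "scalar_product 0 y = 0" for y :: "complex^'n"
    by (simp add: scalar_product_def)
  \<comment> \<open>The two equations are equivalent for any value of the scalar
    \<open>?L \<theta> * c\<close>, so the convergence clause can be matched separately.\<close>
  have "(?L \<theta> * c) *s eigenprojection M \<theta> x = eigenprojection M \<theta> \<mu> \<longleftrightarrow>
      (\<forall>v. eigenpair M v \<theta> \<longrightarrow> ?L \<theta> * c * scalar_product v x = scalar_product v \<mu>)"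
    if "\<theta> \<in> eigenvalue_support M x" for \<theta>
  proof -
    have "\<theta> \<in> spectrum M" using that by (simp add: eigenvalue_support_def)
    from eigenprojection_eq_iff_scalar_product[OF sym this, of "(?L \<theta> * c) *s x" \<mu>]
    have "(?L \<theta> * c) *s eigenprojection M \<theta> x = eigenprojection M \<theta> \<mu> \<longleftrightarrow>
        (\<forall>v\<in>eigenspace M \<theta>. ?L \<theta> * c * scalar_product v x = scalar_product v \<mu>)"
      by (simp only: eigenprojection_smult sp)
    also have "\<dots> \<longleftrightarrow> (\<forall>v. v \<noteq> 0 \<longrightarrow> v \<in> eigenspace M \<theta> \<longrightarrow>
        ?L \<theta> * c * scalar_product v x = scalar_product v \<mu>)"
      by (metis sp0 mult_zero_right)
    finally show ?thesis
      by (simp only: eigenpair_def eigenspace_def mem_Collect_eq imp_conjL)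
  qed
  \<comment> \<open>The eigenpair form yields convergence at \<theta> only through some eigenvector
    for \<theta>.\<close>
  moreover have "\<exists>v. eigenpair M v \<theta>" if "\<theta> \<in> eigenvalue_support M x" for \<theta>
    using that by (simp add: eigenvalue_support_def spectrum_def)
  ultimately show ?thesis by blast
qed

section \<open>Uniform mixing\<close>

text \<open>As the characteristic vector is real, the second factor is the conjugate of the first.
  The defect therefore measures how far the entries of the scaled column are from modulus 1.\<close>

lemma uniform_mixing_defect_component:
  fixes U :: "complex^'n^'n"
  shows "((U *v char_vec u) * (map_matrix cnj U *v char_vec u) - (1 / of_nat CARD('n)) *s vec 1) $ j
    = complex_of_real
        (((cmod ((complex_of_real (sqrt (real CARD('n))) *s (U *v char_vec u)) $ j))\<^sup>2 - 1) / real CARD('n))"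
proof -
  have col: "(A *v char_vec u) $ j = A $ j $ u" for A :: "complex^'n^'n"
    by (simp add: matrix_vector_mult_def axis_def if_distrib cong: if_cong)
  show ?thesis
    by (simp add: col norm_mult power_mult_distrib complex_norm_square[symmetric] diff_divide_distrib
        del: vec_1)
qed

lemma norm_vec_unimodular:
  fixes \<mu> :: "complex^'n"
  assumes "\<And>j. cmod (\<mu> $ j) = 1"
  shows "norm \<mu> = sqrt (real CARD('n))"
  by (simp add: norm_vec_def L2_set_def assms)

lemma mixing_iff_transition_limit:
  fixes M :: "real^'n^'n"
  assumes sym: "transpose M = M"
  shows "local_eps_uniform_mixing M u \<longleftrightarrow>
    (\<exists>(\<tau>::nat \<Rightarrow> real) (\<mu>::complex^'n). (\<forall>j. cmod (\<mu> $ j) = 1) \<and>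
       (\<lambda>m. complex_of_real (sqrt (real CARD('n))) *s (transition_matrix M (\<tau> m) *v char_vec u))
         \<longlonglongrightarrow> \<mu>)"
proof -
  let ?n = "real CARD('n)"
  define y where "y t = complex_of_real (sqrt ?n) *s (transition_matrix M t *v char_vec u)" for t
  define d where "d t = (transition_matrix M t *v char_vec u) *
      (map_matrix cnj (transition_matrix M t) *v char_vec u) - (1 / of_nat CARD('n)) *s vec 1" for t
  have d: "d t $ j = complex_of_real (((cmod (y t $ j))\<^sup>2 - 1) / ?n)" for t j
    unfolding d_def y_def by (rule uniform_mixing_defect_component)
  have "local_eps_uniform_mixing M u \<longleftrightarrow> (\<forall>\<epsilon>>0. \<exists>t. norm (d t) < \<epsilon>)"
    by (simp add: local_eps_uniform_mixing_def d_def)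
  also have "\<dots> \<longleftrightarrow> (\<exists>\<tau> \<mu>. (\<forall>j. cmod (\<mu> $ j) = 1) \<and> (\<lambda>m::nat. y (\<tau> m)) \<longlonglongrightarrow> \<mu>)"
  proof
    assume "\<forall>\<epsilon>>0. \<exists>t. norm (d t) < \<epsilon>"
    then have "\<forall>m. \<exists>t. norm (d t) < inverse (real (Suc m))" by simp
    then obtain \<sigma> where \<sigma>: "\<And>m. norm (d (\<sigma> m)) < inverse (real (Suc m))" by metis
    have d0: "(\<lambda>m. d (\<sigma> m)) \<longlonglongrightarrow> 0"
      using \<sigma> by (intro Lim_null_comparison[OF _ LIMSEQ_inverse_real_of_nat])
        (auto intro!: always_eventually less_imp_le)
    \<comment> \<open>Unitarity keeps every \<open>y t\<close> at the norm of \<open>y 0\<close>, so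
      a compact ball supplies a convergent subsequence.\<close>
    have mem: "\<forall>m. y (\<sigma> m) \<in> cball 0 (norm (y 0))"
      by (simp add: y_def norm_smult norm_transition_matrix_mult[OF sym])
    from seq_compactE[OF compact_imp_seq_compact[OF compact_cball] mem]
    obtain \<mu> r where r: "strict_mono r" and lim: "((\<lambda>m. y (\<sigma> m)) \<circ> r) \<longlonglongrightarrow> \<mu>"
      by blast
    from lim have lim: "(\<lambda>m. y (\<sigma> (r m))) \<longlonglongrightarrow> \<mu>"
      by (simp only: comp_def)
    have "cmod (\<mu> $ j) = 1" for j
    proof -
      \<comment> \<open>Each defect entry has two limits along the subsequence, one by continuity of
        the modulus and one by the choice of times; their equality makes the modulus 1.\<close>
      have "(\<lambda>m. d (\<sigma> (r m)) $ j) \<longlonglongrightarrow> complex_of_real (((cmod (\<mu> $ j))\<^sup>2 - 1) / ?n)"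
        unfolding d by (intro tendsto_intros lim) auto
      moreover have "(\<lambda>m. d (\<sigma> (r m)) $ j) \<longlonglongrightarrow> 0 $ j"
        using LIMSEQ_subseq_LIMSEQ[OF d0 r] by (intro tendsto_vec_nth) (simp add: comp_def)
      ultimately have "complex_of_real (((cmod (\<mu> $ j))\<^sup>2 - 1) / ?n) = 0"
        using LIMSEQ_unique by fastforce
      then have "(cmod (\<mu> $ j))\<^sup>2 = 1"
        by (simp del: of_real_divide of_real_diff)
      then show ?thesis
        by (simp add: power2_eq_1_iff) (smt (verit) norm_ge_zero)
    qed
    with lim show "\<exists>\<tau> \<mu>. (\<forall>j. cmod (\<mu> $ j) = 1) \<and> (\<lambda>m::nat. y (\<tau> m)) \<longlonglongrightarrow> \<mu>"
      by (intro exI[of _ "\<lambda>m. \<sigma> (r m)"]) blast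
  next
    assume "\<exists>\<tau> \<mu>. (\<forall>j. cmod (\<mu> $ j) = 1) \<and> (\<lambda>m::nat. y (\<tau> m)) \<longlonglongrightarrow> \<mu>"
    then obtain \<tau> \<mu> where \<mu>: "\<And>j. cmod (\<mu> $ j) = 1" and lim: "(\<lambda>m::nat. y (\<tau> m)) \<longlonglongrightarrow> \<mu>"
      by blast
    have "(\<lambda>m. d (\<tau> m)) \<longlonglongrightarrow> 0"
    proof (rule vec_tendstoI)
      fix j
      have "(\<lambda>m. d (\<tau> m) $ j) \<longlonglongrightarrow> complex_of_real (((cmod (\<mu> $ j))\<^sup>2 - 1) / ?n)"
        unfolding d by (intro tendsto_intros lim) auto
      then show "(\<lambda>m. d (\<tau> m) $ j) \<longlonglongrightarrow> 0 $ j" by (simp add: \<mu>)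
    qed
    then show "\<forall>\<epsilon>>0. \<exists>t. norm (d t) < \<epsilon>"
      by (metis LIMSEQ_iff diff_zero order_refl)
  qed
  finally show ?thesis by (simp only: y_def)
qed

text \<open>Edges are unordered pairs and degrees sit on the diagonal; the resulting symmetry gives
  access to the spectral results.\<close>

lemma transpose_graph_matrix:
  assumes "M \<in> {adjacency_matrix E w, laplacian E w, signless_laplacian E w}"
  shows "transpose M = M"
proof -
  have "adjacency_matrix E w $ i $ j = adjacency_matrix E w $ j $ i"
    "degree_matrix E w $ i $ j = degree_matrix E w $ j $ i" for i j
    by (auto simp: adjacency_matrix_def degree_matrix_def insert_commute)
  then show ?thesis
    using assms by (auto simp: vec_eq_iff transpose_def laplacian_def signless_laplacian_def)
qed

theorem proposition1:
  fixes E :: "'n::finite set set" and w :: "'n set \<Rightarrow> real"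
    and M :: "real^'n^'n" and u :: 'n
  assumes "weighted_graph E w"
    and "M \<in> {adjacency_matrix E w, laplacian E w, signless_laplacian E w}"
  shows
    "(local_eps_uniform_mixing M u \<longleftrightarrow>
        (\<exists>(\<tau>::nat \<Rightarrow> real) (\<mu>::complex^'n). (\<forall>j. cmod (\<mu> $ j) = 1) \<and>
           (\<lambda>m. complex_of_real (sqrt (real CARD('n))) *s (transition_matrix M (\<tau> m) *v char_vec u))
             \<longlonglongrightarrow> \<mu>)) \<and>
     (local_eps_uniform_mixing M u \<longleftrightarrow>
        (\<exists>(\<tau>::nat \<Rightarrow> real) (\<mu>::complex^'n). (\<forall>j. cmod (\<mu> $ j) = 1) \<and>
           (\<forall>\<theta>\<in>eigenvalue_support M (char_vec u).
              convergent (\<lambda>m. exp (\<i> * complex_of_real (\<tau> m) * \<theta>)) \<and>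
              (lim (\<lambda>m. exp (\<i> * complex_of_real (\<tau> m) * \<theta>)) * complex_of_real (sqrt (real CARD('n))))
                *s eigenprojection M \<theta> (char_vec u) = eigenprojection M \<theta> \<mu>))) \<and>
     (\<forall>(\<tau>::nat \<Rightarrow> real) (\<mu>::complex^'n). (\<forall>j. cmod (\<mu> $ j) = 1) \<longrightarrow>
        ((\<forall>\<theta>\<in>eigenvalue_support M (char_vec u).
            convergent (\<lambda>m. exp (\<i> * complex_of_real (\<tau> m) * \<theta>)) \<and>
            (lim (\<lambda>m. exp (\<i> * complex_of_real (\<tau> m) * \<theta>)) * complex_of_real (sqrt (real CARD('n))))
              *s eigenprojection M \<theta> (char_vec u) = eigenprojection M \<theta> \<mu>)
         \<longleftrightarrow>
         (\<forall>v \<theta>. eigenpair M v \<theta> \<and> \<theta> \<in> eigenvalue_support M (char_vec u) \<longrightarrow>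
            convergent (\<lambda>m. exp (\<i> * complex_of_real (\<tau> m) * \<theta>)) \<and>
            lim (\<lambda>m. exp (\<i> * complex_of_real (\<tau> m) * \<theta>)) * complex_of_real (sqrt (real CARD('n)))
              * scalar_product v (char_vec u) = scalar_product v \<mu>)))"
proof -
  have sym: "transpose M = M"
    by (rule transpose_graph_matrix[OF assms(2)])
  have "norm (char_vec u :: complex^'n) = 1"
    by (simp add: norm_eq_sqrt_inner inner_axis_axis)
  \<comment> \<open>Both sides are the square root of the number of vertices, which is the norm
    condition of the limit criterion.\<close>
  then have "norm \<mu> = norm (complex_of_real (sqrt (real CARD('n))) *s char_vec u :: complex^'n)"
    if "\<forall>j. cmod (\<mu> $ j) = 1" for \<mu> :: "complex^'n"
    using norm_vec_unimodular[of \<mu>] that by (simp add: norm_smult)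
  then have lim_iff: "(\<lambda>m. complex_of_real (sqrt (real CARD('n))) *s (transition_matrix M (\<tau> m) *v char_vec u))
        \<longlonglongrightarrow> \<mu> \<longleftrightarrow>
      (\<forall>\<theta>\<in>eigenvalue_support M (char_vec u).
         convergent (\<lambda>m. exp (\<i> * complex_of_real (\<tau> m) * \<theta>)) \<and>
         (lim (\<lambda>m. exp (\<i> * complex_of_real (\<tau> m) * \<theta>)) * complex_of_real (sqrt (real CARD('n))))
           *s eigenprojection M \<theta> (char_vec u) = eigenprojection M \<theta> \<mu>)"
    if "\<forall>j. cmod (\<mu> $ j) = 1" for \<tau> :: "nat \<Rightarrow> real" and \<mu> :: "complex^'n"
    using that by (intro transition_limit_iff_eigenprojections[OF sym]) auto
  note mixing = mixing_iff_transition_limit[OF sym, of u]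
  show ?thesis
    \<comment> \<open>Rewriting the eigenpair condition back to projections turns the last conjunct
      into a tautology.\<close>
    unfolding eigenprojections_iff_eigenpairs[OF sym, symmetric]
    using mixing lim_iff by blast
qed

end
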